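(* Let $W\subset V\otimes\mathbb{R}^\ell$ be a linear subspace, $\varphi\colon W\to V$ a linear operator, $\alpha\in(0,1)$, and assume $$\alpha>-\frac{\kappa'(1)}{\log m}.$$ Then for any $\theta\in(0,1)$ sufficiently close to $1$, the function $$G(x,y,z,t,s)=|y|t+M_1|x|t^{1-\theta}s^\theta+M_2(z-|x|)s$$ on $\Omega$ is a supersolution provided $1\ll M_1\ll M_2$ (depending on $\theta$), i.e. provided $M_1$ is sufficiently large (depending on $\theta$) and $M_2$ is sufficiently large (depending on $\theta$ and $M_1$).
   Context: Fix integers $m\geq 2$, $\ell\geq 1$. $\mathbb{R}_+=[0,\infty)$. $V=\{v\in\mathbb{R}^m:\sum_j v_j=0\}$; $V\otimes\mathbb{R}^\ell$ is identified with $\{(w_1,\dots,w_m)\in(\mathbb{R}^\ell)^m:\sum_j w_j=0\}$, and $v\otimes a=(v_1a,\dots,v_ma)$. Let $\mathbb{M}^W=\{v\in V: v_j\ge-1\ \forall j,\ \exists a\in\mathbb{R}^\ell\setminus\{0\}\text{ with }v\otimes a\in W\}$. For $v\in V$ put $\kappa_v(\theta)=\theta\log\big(\frac1m\sum_{j=1}^m|1+v_j|^{1/\theta}\big)$ for $\theta\in(0,1]$ and $\kappa_v(0)=\log\max_j|1+v_j|$; put $\kappa(\theta)=\sup_{v\in\mathbb{M}^W}\kappa_v(\theta)$, $\theta\in[0,1]$; $\kappa'(1)$ is the left derivative of this convex function at $1$. Let $\Omega=\{(x,y,z,t,s)\in\mathbb{R}^\ell\times\mathbb{R}\times\mathbb{R}_+^3:\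 |x|\le z,\ t\le s\}$. The configuration space $\mathfrak{W}$ consists of strings $(\{x_j\}_{j=1}^m,y,\{z_j\}_{j=1}^m,\{t_j\}_{j=1}^m,\{s_j\}_{j=1}^m)$ with $x_j\in\mathbb{R}^\ell$, $y\in\mathbb{R}$, $z_j,t_j,s_j\in\mathbb{R}_+$, $|x_j|\le z_j$, $t_j\le s_j$ such that, with $$x=\tfrac1m\sum_j x_j,\quad z=\tfrac1m\sum_j z_j,\quad t=\sum_j t_j,\quad s=\max\big(t,\,m^{1-\alpha}\max_j s_j\big),\quad \vec{x}=(x_1-x,\dots,x_m-x),$$ one has $\vec{x}\in W$. A function $G\colon\Omega\to\mathbb{R}$ satisfies the main inequality if for every element of $\mathfrak{W}$ (and the corresponding $x,z,t,s,\vec{x}$) $$G(x,y,z,t,s)\ \ge\ m^{-\alpha}\sum_{j=1}^m G\big(x_j,\ m^\alpha y+(\varphi[\vec{x}])_j,\ z_j,\ t_j,\ s_j\big).$$ $G$ is a supersolution if it satisfies the main inequality and the boundary inequality $G(x,y,|x|,t,s)\ge|y|t$ for all $x\in\mathbb{R}^\ell,\ y\in\mathbb{R},\ 0\le t\le s$. *)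

theory Defs
  imports "HOL-Analysis.Analysis"
begin

text \<open>
  The integers $m \ge 2$ and $\ell \ge 1$ are the cardinalities of the finite index types
  \<open>'m\<close> and \<open>'l\<close>; an $m$-tuple of vectors of $\mathbb{R}^\ell$ has type \<open>real^'l^'m\<close>.
\<close>

text \<open>
  For \<open>'a = real\<close> this is $V$, for \<open>'a = real^'l\<close> it is $V \otimes \mathbb{R}^\ell$.
\<close>

definition zero_sum :: "('a::comm_monoid_add ^ 'm) set" where
  "zero_sum = {w. (\<Sum>j\<in>UNIV. w $ j) = 0}"

definition tensor :: "real^'m \<Rightarrow> real^'l \<Rightarrow> real^'l^'m" where
  "tensor v a = (\<chi> j. (v $ j) *\<^sub>R a)"

text \<open>
  A linear operator between the subspaces \<open>W\<close> and \<open>U\<close>; the values of \<open>f\<close> outside \<open>W\<close> are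
  irrelevant.
\<close>

definition linear_operator ::
  "('a::real_vector) set \<Rightarrow> ('b::real_vector) set \<Rightarrow> ('a \<Rightarrow> 'b) \<Rightarrow> bool" where
  "linear_operator W U f \<longleftrightarrow>
     f ` W \<subseteq> U \<and>
     (\<forall>u\<in>W. \<forall>w\<in>W. f (u + w) = f u + f w) \<and>
     (\<forall>c. \<forall>w\<in>W. f (c *\<^sub>R w) = c *\<^sub>R f w)"

definition MW :: "(real^'l^'m) set \<Rightarrow> (real^'m) set" where
  "MW W = {v \<in> zero_sum. (\<forall>j. v $ j \<ge> -1) \<and> (\<exists>a. a \<noteq> 0 \<and> tensor v a \<in> W)}"

text \<open>Only meaningful for \<open>\<theta> \<in> {0..1}\<close>.\<close>

definition kappa_vec :: "real^'m \<Rightarrow> real \<Rightarrow> real" where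
  "kappa_vec v \<theta> =
     (if \<theta> = 0 then ln (Max (range (\<lambda>j. \<bar>1 + v $ j\<bar>)))
      else \<theta> * ln ((1 / real CARD('m)) * (\<Sum>j\<in>UNIV. \<bar>1 + v $ j\<bar> powr (1 / \<theta>))))"

text \<open>
  The supremum is over a nonempty bounded set: \<open>0 \<in> MW W\<close>, and \<open>MW W\<close> is bounded.
\<close>

definition kappa :: "(real^'l^'m) set \<Rightarrow> real \<Rightarrow> real" where
  "kappa W \<theta> = (SUP v\<in>MW W. kappa_vec v \<theta>)"

text \<open>
  The left derivative at $1$.  It exists and is finite because \<open>kappa W\<close> is convex and
  nonnegative on \<open>{0..1}\<close> and vanishes at \<open>1\<close>.
\<close>

definition kappa_deriv_1 :: "(real^'l^'m) set \<Rightarrow> real" where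
  "kappa_deriv_1 W = vector_derivative (kappa W) (at_left 1)"

type_synonym 'l point = "(real^'l) \<times> real \<times> real \<times> real \<times> real"

definition Omega :: "('l::finite) point set" where
  "Omega = {(x, y, z, t, s). 0 \<le> z \<and> 0 \<le> t \<and> 0 \<le> s \<and> norm x \<le> z \<and> t \<le> s}"

definition mean :: "('a::real_vector)^'m \<Rightarrow> 'a" where
  "mean x = (1 / real CARD('m)) *\<^sub>R (\<Sum>j\<in>UNIV. x $ j)"

definition deviation :: "real^'l^'m \<Rightarrow> real^'l^'m" where
  "deviation x = (\<chi> j. x $ j - mean x)"

definition vsum :: "real^'m \<Rightarrow> real" where
  "vsum t = (\<Sum>j\<in>UNIV. t $ j)"

definition combined_s :: "real \<Rightarrow> real^'m \<Rightarrow> real^'m \<Rightarrow> real" where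
  "combined_s \<alpha> t s =
     max (vsum t) (real CARD('m) powr (1 - \<alpha>) * Max (range (\<lambda>j. s $ j)))"

definition config_space ::
  "(real^'l^'m) set \<Rightarrow> ((real^'l^'m) \<times> real \<times> (real^'m) \<times> (real^'m) \<times> (real^'m)) set" where
  "config_space W =
     {(x, y, z, t, s). (\<forall>j. (x $ j, y, z $ j, t $ j, s $ j) \<in> Omega) \<and> deviation x \<in> W}"

text \<open>
  A function $G \colon \Omega \to \mathbb{R}$ is represented by a total function.  The two
  inequalities below evaluate it at points of
  \<open>Omega\<close> only, as the lemmas at the end show.
\<close>

definition main_inequality ::
  "(real^'l^'m) set \<Rightarrow> (real^'l^'m \<Rightarrow> real^'m) \<Rightarrow> real \<Rightarrow> ('l::finite point \<Rightarrow> real) \<Rightarrow> bool" where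
  "main_inequality W \<phi> \<alpha> G \<longleftrightarrow>
     (\<forall>(x, y, z, t, s) \<in> config_space W.
        G (mean x, y, mean z, vsum t, combined_s \<alpha> t s) \<ge>
          real CARD('m) powr (-\<alpha>) *
          (\<Sum>j\<in>UNIV. G (x $ j, real CARD('m) powr \<alpha> * y + \<phi> (deviation x) $ j,
                         z $ j, t $ j, s $ j)))"

definition boundary_inequality :: "('l::finite point \<Rightarrow> real) \<Rightarrow> bool" where
  "boundary_inequality G \<longleftrightarrow>
     (\<forall>x y t s. 0 \<le> t \<and> t \<le> s \<longrightarrow> G (x, y, norm x, t, s) \<ge> \<bar>y\<bar> * t)"

definition supersolution ::
  "(real^'l^'m) set \<Rightarrow> (real^'l^'m \<Rightarrow> real^'m) \<Rightarrow> real \<Rightarrow> ('l::finite point \<Rightarrow> real) \<Rightarrow> bool" where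
  "supersolution W \<phi> \<alpha> G \<longleftrightarrow> main_inequality W \<phi> \<alpha> G \<and> boundary_inequality G"

definition G_fun :: "real \<Rightarrow> real \<Rightarrow> real \<Rightarrow> 'l::finite point \<Rightarrow> real" where
  "G_fun \<theta> M\<^sub>1 M\<^sub>2 = (\<lambda>(x, y, z, t, s).
     \<bar>y\<bar> * t + M\<^sub>1 * norm x * t powr (1 - \<theta>) * s powr \<theta> + M\<^sub>2 * (z - norm x) * s)"

lemma mean_in_Omega:
  fixes x :: "real^'l^'m"
  assumes "(x, y, z, t, s) \<in> config_space W"
  shows "(mean x, y, mean z, vsum t, combined_s \<alpha> t s) \<in> Omega"
proof -
  have *: "norm (x $ j) \<le> z $ j" "0 \<le> z $ j" "0 \<le> t $ j" for j
    using assms by (auto simp: config_space_def Omega_def)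
  have "norm (\<Sum>j\<in>UNIV. x $ j) \<le> (\<Sum>j\<in>UNIV. z $ j)"
    by (rule sum_norm_le) (use * in auto)
  then have "norm (mean x) \<le> mean z"
    by (simp add: mean_def divide_right_mono)
  moreover have "0 \<le> mean z" "0 \<le> vsum t"
    using * by (auto simp: mean_def vsum_def intro!: sum_nonneg divide_nonneg_nonneg)
  ultimately show ?thesis
    by (auto simp: Omega_def combined_s_def)
qed

lemma component_in_Omega:
  assumes "(x, y, z, t, s) \<in> config_space W"
  shows "(x $ j, y', z $ j, t $ j, s $ j) \<in> Omega"
  using assms by (auto simp: config_space_def Omega_def)

lemma boundary_in_Omega: "0 \<le> t \<Longrightarrow> t \<le> s \<Longrightarrow> (x, y, norm x, t, s) \<in> Omega"
  by (auto simp: Omega_def)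

end

theory Submission
  imports Defs
begin

text \<open>
  Write \<open>X\<close> for the tuple $(x_j)$ with mean $x$ and deviation $w$, and put
  $D = \frac1m \sum_j |x_j| - |x| \ge 0$,
  $N_\theta = (\frac1m \sum_j |x_j|^{1/\theta})^\theta$ and
  $\tau = t^{1-\theta} s^\theta$, so that $t \le \tau \le s$.  Since
  $s_j \le m^{\alpha-1} s$, the three terms of $G$ on the right-hand side of the main
  inequality are at most
  $|y| t + C |w| t$ (as $\varphi$ is bounded on $W$),
  $M_1 m^{-\alpha(1-\theta)} N_\theta \tau$ (by Hoelder's inequality), and
  $M_2 (z - |x| - D) s$.
  Because $t \le \tau \le s$, the main inequality thus reduces to an inequality on tuples alone:
  \[ C |w| \le M_1 (|x| - m^{-\alpha(1-\theta)} N_\theta) + M_2 D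
     \quad \mbox{whenever } w \in W \]
  (\<open>supersolution_if_tuple_inequality\<close>).

  Where $D > 0$, a large $M_2$ settles it.  Where $D = 0$ and $X \ne 0$, the triangle inequality is an
  equality and $x \ne 0$, so all $x_j$ are nonnegative multiples $(1 + v_j) x$ of $x$; then $w = v \otimes x$
  with $v \in \mathbb{M}^W$, and this is how that set enters.  On such tuples
  $N_\theta = e^{\kappa_v(\theta)} |x| \le e^{\kappa(\theta)} |x|$, so the coefficient of $M_1$ is
  at least $(1 - e^{\kappa(\theta) - \alpha (1-\theta) \log m}) |x|$, while $|w| \le 2m|x|$.  Hence
  if $\kappa(\theta) < \alpha (1 - \theta) \log m$, a large $M_1$ gives strict inequality there.
  By homogeneity and compactness of the unit sphere, one $M_2$ then serves
  for all tuples (\<open>compact_penalization\<close>, \<open>eventually_tuple_inequality\<close>).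

  As $\kappa(1) = 0$, the condition $\kappa(\theta) < \alpha (1 - \theta) \log m$ for
  $\theta$ near $1$ is what the hypothesis on $\kappa'(1)$ provides, once the left
  derivative is known to exist.  Existence follows from the monotonicity of
  $\kappa(\theta) / (1 - \theta)$, again by Hoelder's inequality (\<open>kappa_slope_tendsto\<close>).
\<close>

section \<open>Hoelder's inequality\<close>

text \<open>
  After normalizing both sums to $1$, this is Young's inequality
  $a^\theta b^{1-\theta} \le \theta a + (1-\theta) b$ summed over the index set.
\<close>

lemma Holder_sum:
  fixes f g :: "'i \<Rightarrow> real"
  assumes "finite S" and \<theta>: "0 < \<theta>" "\<theta> < 1"
    and f: "\<And>i. i \<in> S \<Longrightarrow> 0 \<le> f i" and g: "\<And>i. i \<in> S \<Longrightarrow> 0 \<le> g i"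
  shows "(\<Sum>i\<in>S. f i powr \<theta> * g i powr (1 - \<theta>)) \<le> sum f S powr \<theta> * sum g S powr (1 - \<theta>)"
proof (cases "sum f S = 0 \<or> sum g S = 0")
  case True
  then have "(\<forall>i\<in>S. f i = 0) \<or> (\<forall>i\<in>S. g i = 0)"
    using sum_nonneg_eq_0_iff[OF \<open>finite S\<close>] f g by meson
  then have "(\<Sum>i\<in>S. f i powr \<theta> * g i powr (1 - \<theta>)) = 0"
    by (auto intro: sum.neutral)
  then show ?thesis by simp
next
  case False
  define F where "F = sum f S"
  define G where "G = sum g S"
  have pos: "0 < F" "0 < G"
    using False sum_nonneg[of S f] sum_nonneg[of S g] f g by (auto simp: F_def G_def less_le)
  have "f i powr \<theta> * g i powr (1 - \<theta>)
      \<le> F powr \<theta> * G powr (1 - \<theta>) * (\<theta> * (f i / F) + (1 - \<theta>) * (g i / G))" if "i \<in> S" for i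
  proof (cases "f i = 0 \<or> g i = 0")
    case True
    then have "f i powr \<theta> * g i powr (1 - \<theta>) = 0" by auto
    moreover have "0 \<le> \<theta> * (f i / F) + (1 - \<theta>) * (g i / G)"
      using f[OF that] g[OF that] pos \<theta> by simp
    ultimately show ?thesis by (metis mult_nonneg_nonneg powr_ge_zero)
  next
    case False
    then have "0 < f i" "0 < g i" using f[OF that] g[OF that] by auto
    then have "(f i / F) powr \<theta> * (g i / G) powr (1 - \<theta>) \<le> \<theta> * (f i / F) + (1 - \<theta>) * (g i / G)"
      using pos \<theta> by (intro Youngs_inequality_0) auto
    then show ?thesis
      using pos \<open>0 < f i\<close> \<open>0 < g i\<close> by (simp add: powr_divide field_simps)
  qed
  then have "(\<Sum>i\<in>S. f i powr \<theta> * g i powr (1 - \<theta>))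
      \<le> (\<Sum>i\<in>S. F powr \<theta> * G powr (1 - \<theta>) * (\<theta> * (f i / F) + (1 - \<theta>) * (g i / G)))"
    by (rule sum_mono)
  also have "\<dots> = F powr \<theta> * G powr (1 - \<theta>) * (\<theta> * (sum f S / F) + (1 - \<theta>) * (sum g S / G))"
    by (simp only: sum_distrib_left[symmetric] sum.distrib sum_divide_distrib[symmetric])
  also have "\<dots> = F powr \<theta> * G powr (1 - \<theta>)"
    using pos unfolding F_def[symmetric] G_def[symmetric] by simp
  finally show ?thesis by (simp add: F_def G_def)
qed

section \<open>The left derivative of \<open>kappa\<close> at 1\<close>

lemma MW_zero:
  fixes W :: "(real^'l^'m) set"
  assumes "subspace W"
  shows "0 \<in> MW W"
proof -
  have "tensor 0 (1 :: real^'l) = (0 :: real^'l^'m)" by (simp add: tensor_def vec_eq_iff)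
  then have "tensor 0 (1 :: real^'l) \<in> W" using assms by (simp add: subspace_0)
  moreover have "(1 :: real^'l) \<noteq> 0" by (simp add: vec_eq_iff)
  ultimately have "\<exists>a::real^'l. a \<noteq> 0 \<and> tensor 0 a \<in> W" by blast
  then show ?thesis by (simp add: MW_def zero_sum_def)
qed

lemma MW_nonneg:
  assumes "v \<in> MW W"
  shows "0 \<le> 1 + v $ j"
proof -
  have "- 1 \<le> v $ j" using assms by (simp add: MW_def)
  then show ?thesis by linarith
qed

lemma MW_sum:
  fixes v :: "real^'m"
  shows "v \<in> MW W \<Longrightarrow> (\<Sum>j\<in>UNIV. 1 + v $ j) = real CARD('m)"
  by (simp add: MW_def zero_sum_def sum.distrib)

text \<open>
  With $p = 1/\theta$ this is the argument of the logarithm in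
  $\kappa_v(\theta)$.
\<close>

definition moment :: "real^'m \<Rightarrow> real \<Rightarrow> real" where
  "moment v p = (1 / real CARD('m)) * (\<Sum>j\<in>UNIV. \<bar>1 + v $ j\<bar> powr p)"

lemma kappa_vec_eq: "\<theta> \<noteq> 0 \<Longrightarrow> kappa_vec v \<theta> = \<theta> * ln (moment v (1 / \<theta>))"
  by (simp add: kappa_vec_def moment_def)

lemma moment_pos:
  assumes "v \<in> MW W"
  shows "0 < moment v p"
proof -
  have "\<exists>j. 1 + v $ j \<noteq> 0"
  proof (rule ccontr)
    assume "\<not> ?thesis"
    then show False using MW_sum[OF assms] by simp
  qed
  then obtain j where "1 + v $ j \<noteq> 0" ..
  then have "0 < (\<Sum>j\<in>UNIV. \<bar>1 + v $ j\<bar> powr p)"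
    by (intro sum_pos2[where i = j]) auto
  then show ?thesis by (simp add: moment_def)
qed

lemma moment_1: "v \<in> MW W \<Longrightarrow> moment v 1 = 1"
  using MW_sum[of v W] MW_nonneg[of v W] by (simp add: moment_def)

text \<open>
  The entries $1 + v_j$ are nonnegative with sum $m$, so each is at most $m$.  The bound is uniform
  in $v$, which makes the supremum defining \<open>kappa\<close> a genuine one.
\<close>

lemma kappa_vec_le:
  fixes v :: "real^'m"
  assumes v: "v \<in> MW W" and \<theta>: "0 < \<theta>"
  shows "kappa_vec v \<theta> \<le> ln (real CARD('m))"
proof -
  have le: "1 + v $ j \<le> real CARD('m)" for j
    using member_le_sum[of j UNIV "\<lambda>j. 1 + v $ j"] MW_sum[OF v] MW_nonneg[OF v] by simp
  have "moment v (1 / \<theta>)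
      \<le> (1 / real CARD('m)) * (\<Sum>j\<in>(UNIV::'m set). real CARD('m) powr (1 / \<theta>))"
    unfolding moment_def using le MW_nonneg[OF v] \<theta>
    by (intro mult_left_mono sum_mono powr_mono2) auto
  also have "\<dots> = real CARD('m) powr (1 / \<theta>)" by simp
  finally have "ln (moment v (1 / \<theta>)) \<le> ln (real CARD('m) powr (1 / \<theta>))"
    using moment_pos[OF v] by (subst ln_le_cancel_iff) (auto intro: less_le_trans)
  then show ?thesis using \<theta> by (simp add: kappa_vec_eq ln_powr field_simps)
qed

lemma kappa_vec_le_kappa:
  assumes "v \<in> MW W" "0 < \<theta>"
  shows "kappa_vec v \<theta> \<le> kappa W \<theta>"
  unfolding kappa_def using assms kappa_vec_le by (intro cSUP_upper bdd_aboveI2) auto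

lemma kappa_nonneg:
  fixes W :: "(real^'l^'m) set"
  assumes "subspace W" "0 < \<theta>"
  shows "0 \<le> kappa W \<theta>"
proof -
  have "kappa_vec (0 :: real^'m) \<theta> = 0" using assms by (simp add: kappa_vec_def)
  then show ?thesis using kappa_vec_le_kappa[OF MW_zero] assms by metis
qed

lemma kappa_1:
  fixes W :: "(real^'l^'m) set"
  assumes "subspace W"
  shows "kappa W 1 = 0"
proof -
  have "kappa_vec v 1 = 0" if "v \<in> MW W" for v
    using moment_1[OF that] by (simp add: kappa_vec_eq)
  then have "kappa W 1 = (SUP v\<in>MW W. 0)" unfolding kappa_def by (intro SUP_cong) auto
  then show ?thesis using MW_zero[OF assms] by (metis cSUP_const empty_iff)
qed

text \<open>
  For $v \in \mathbb{M}^W$ the first moment is $1$.  Interpolating the moment of order $1/\eta$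
  between those of orders $1/\theta$ and $1$ by Hoelder's inequality bounds it by a power of the
  moment of order $1/\theta$; in logarithms, $\kappa_v(\eta)/(1-\eta) \le \kappa_v(\theta)/(1-\theta)$.
  This is the part of convexity of $\kappa_v$ that concerns chords ending at $1$.
\<close>

lemma kappa_vec_slope_antimono:
  fixes v :: "real^'m"
  assumes v: "v \<in> MW W" and \<theta>: "0 < \<theta>" "\<theta> < \<eta>" "\<eta> < 1"
  shows "kappa_vec v \<eta> \<le> (1 - \<eta>) / (1 - \<theta>) * kappa_vec v \<theta>"
proof -
  \<comment> \<open>The interpolation parameter solves $1/\eta = r/\theta + (1-r)$.\<close>
  define r where "r = (1 - \<eta>) * \<theta> / (\<eta> * (1 - \<theta>))"
  have r: "0 < r" "r < 1" using \<theta> by (auto simp: r_def field_simps)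
  have exponent: "1 / \<theta> * r + (1 - r) = 1 / \<eta>"
  proof -
    have "1 / \<theta> * r + (1 - r) = 1 + (1 - \<theta>) / \<theta> * r" using \<theta> by (simp add: field_simps)
    also have "(1 - \<theta>) / \<theta> * r = (1 - \<eta>) / \<eta>" using \<theta> by (simp add: r_def)
    finally show ?thesis using \<theta> by (simp add: field_simps)
  qed
  \<comment> \<open>Each factor carries its own weight $1/m$, so that the sums in Hoelder's inequality are moments.\<close>
  define c where "c = 1 / real CARD('m)"
  have c: "0 < c" by (simp add: c_def)
  let ?a = "\<lambda>j. \<bar>1 + v $ j\<bar>"
  have split: "c * ?a j powr (1 / \<eta>) = (c * ?a j powr (1 / \<theta>)) powr r * (c * ?a j powr 1) powr (1 - r)" for j
  proof -
    have "(c * ?a j powr (1 / \<theta>)) powr r * (c * ?a j powr 1) powr (1 - r)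
        = (c powr r * c powr (1 - r)) * (?a j powr (1 / \<theta> * r) * ?a j powr (1 - r))"
      using c by (simp add: powr_mult powr_powr)
    also have "c powr r * c powr (1 - r) = c" using c by (simp flip: powr_add)
    also have "?a j powr (1 / \<theta> * r) * ?a j powr (1 - r) = ?a j powr (1 / \<eta>)"
      using exponent by (simp flip: powr_add)
    finally show ?thesis by simp
  qed
  have "moment v (1 / \<eta>)
      = (\<Sum>j\<in>UNIV. (c * ?a j powr (1 / \<theta>)) powr r * (c * ?a j powr 1) powr (1 - r))"
    unfolding moment_def c_def[symmetric] sum_distrib_left split ..
  also have "\<dots> \<le> moment v (1 / \<theta>) powr r * moment v 1 powr (1 - r)"
    unfolding moment_def c_def[symmetric] sum_distrib_left
    using r c by (intro Holder_sum) auto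
  also have "\<dots> = moment v (1 / \<theta>) powr r" using moment_1[OF v] by simp
  finally have "ln (moment v (1 / \<eta>)) \<le> ln (moment v (1 / \<theta>) powr r)"
    using moment_pos[OF v, of "1 / \<eta>"] by (intro ln_mono) (auto simp del: ln_powr)
  also have "\<dots> = r * ln (moment v (1 / \<theta>))"
    using moment_pos[OF v] by (simp add: ln_powr)
  finally have "\<eta> * ln (moment v (1 / \<eta>)) \<le> \<eta> * (r * ln (moment v (1 / \<theta>)))"
    using \<theta> by (intro mult_left_mono) auto
  also have "\<dots> = (1 - \<eta>) / (1 - \<theta>) * (\<theta> * ln (moment v (1 / \<theta>)))"
    using \<theta> by (simp add: r_def)
  finally show ?thesis using \<theta> by (simp add: kappa_vec_eq)
qed

lemma kappa_slope_antimono: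
  fixes W :: "(real^'l^'m) set"
  assumes "subspace W" and \<theta>: "0 < \<theta>" "\<theta> < \<eta>" "\<eta> < 1"
  shows "kappa W \<eta> \<le> (1 - \<eta>) / (1 - \<theta>) * kappa W \<theta>"
  unfolding kappa_def[of W \<eta>]
proof (rule cSUP_least)
  show "MW W \<noteq> {}" using MW_zero[OF assms(1)] by auto
  fix v assume v: "v \<in> MW W"
  have "kappa_vec v \<eta> \<le> (1 - \<eta>) / (1 - \<theta>) * kappa_vec v \<theta>" using v \<theta> by (rule kappa_vec_slope_antimono)
  also have "\<dots> \<le> (1 - \<eta>) / (1 - \<theta>) * kappa W \<theta>"
    using kappa_vec_le_kappa[OF v] \<theta> by (intro mult_left_mono) auto
  finally show "kappa_vec v \<eta> \<le> (1 - \<eta>) / (1 - \<theta>) * kappa W \<theta>" .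
qed

text \<open>
  The difference quotient of \<open>kappa\<close> at $1$ increases with $\theta$ on $(0,1)$ and is bounded above by $0$, so
  it converges from the left.  Hence \<open>kappa_deriv_1\<close>, a \<open>vector_derivative\<close> and
  so unspecified where no derivative exists, is the actual limit.
\<close>

lemma kappa_slope_tendsto:
  fixes W :: "(real^'l^'m) set"
  assumes "subspace W"
  shows "((\<lambda>\<theta>. kappa W \<theta> / (\<theta> - 1)) \<longlongrightarrow> kappa_deriv_1 W) (at_left 1)"
proof -
  let ?q = "\<lambda>\<theta>. kappa W \<theta> / (\<theta> - 1)"
  have eq: "{..<1} \<inter> {0<..} = {0<..<1::real}" by auto
  have at_left_eq: "at 1 within {0<..<1} = at_left (1::real)"
    by (rule at_within_nhd[where S = "{0<..}"]) auto
  have "(?q \<longlongrightarrow> Sup (?q ` ({..<1} \<inter> {0<..}))) (at 1 within ({..<1} \<inter> {0<..}))"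
  proof (rule Lim_left_bound)
    fix a b :: real assume ab: "a \<in> {0<..}" "b \<in> {0<..}" "b < 1" "a \<le> b"
    show "?q a \<le> ?q b"
    proof (cases "a = b")
      case False
      then have "kappa W b \<le> (1 - b) / (1 - a) * kappa W a"
        using kappa_slope_antimono[OF assms, of a b] ab by auto
      then show ?thesis using ab False by (simp add: divide_simps) (simp add: algebra_simps)
    qed simp
  next
    fix b :: real assume "b \<in> {0<..}" "b < 1"
    then show "?q b \<le> 0" using kappa_nonneg[OF assms, of b] by (simp add: divide_nonneg_neg)
  qed
  then obtain D where D: "(?q \<longlongrightarrow> D) (at_left 1)"
    unfolding eq at_left_eq by blast
  then have "(kappa W has_field_derivative D) (at_left 1)"
    by (simp add: has_field_derivative_iff kappa_1[OF assms])
  then have "(kappa W has_vector_derivative D) (at_left 1)"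
    by (simp add: has_real_derivative_iff_has_vector_derivative)
  then have "kappa_deriv_1 W = D"
    unfolding kappa_deriv_1_def by (intro vector_derivative_within) auto
  then show ?thesis using D by simp
qed

lemma kappa_below_line_near_1:
  fixes W :: "(real^'l^'m) set"
  assumes "subspace W" and "- kappa_deriv_1 W < c"
  shows "\<exists>\<theta>\<^sub>0<1. \<forall>\<theta>. \<theta>\<^sub>0 < \<theta> \<and> \<theta> < 1 \<longrightarrow> kappa W \<theta> < c * (1 - \<theta>)"
proof -
  have "\<forall>\<^sub>F \<theta> in at_left 1. - c < kappa W \<theta> / (\<theta> - 1)"
    using order_tendstoD(1)[OF kappa_slope_tendsto[OF assms(1)], of "- c"] assms(2) by simp
  then obtain b :: real where "b < 1" and b: "\<And>\<theta>. b < \<theta> \<Longrightarrow> \<theta> < 1 \<Longrightarrow> - c < kappa W \<theta> / (\<theta> - 1)"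
    by (auto simp: eventually_at_left[of 0 1, simplified])
  have "kappa W \<theta> < c * (1 - \<theta>)" if "b < \<theta>" "\<theta> < 1" for \<theta>
    using b[OF that] that by (simp add: field_simps)
  with \<open>b < 1\<close> show ?thesis by blast
qed

section \<open>Boundedness and compactness\<close>

text \<open>
  The operator is linear on \<open>W\<close> only, so the boundedness of linear maps
  is applied to a linear extension of it from a basis of \<open>W\<close>.
\<close>

lemma linear_operator_bounded:
  fixes \<phi> :: "'a::euclidean_space \<Rightarrow> 'b::euclidean_space"
  assumes W: "subspace W" and \<phi>: "linear_operator W U \<phi>"
  shows "\<exists>C\<ge>0. \<forall>w\<in>W. norm (\<phi> w) \<le> C * norm w"
proof -
  obtain B where B: "B \<subseteq> W" "independent B" "span B = W"
    using W by (metis basis_exists span_subspace)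
  obtain g where g: "linear g" "\<And>w. w \<in> B \<Longrightarrow> g w = \<phi> w"
    using linear_independent_extend[OF B(2)] by metis
  have add: "\<phi> (u + w) = \<phi> u + \<phi> w" if "u \<in> W" "w \<in> W" for u w
    using \<phi> that by (auto simp: linear_operator_def)
  have scale: "\<phi> (c *\<^sub>R w) = c *\<^sub>R \<phi> w" if "w \<in> W" for c w
    using \<phi> that by (auto simp: linear_operator_def)
  have "subspace {w \<in> W. g w = \<phi> w}"
    unfolding subspace_def using W add scale g(1) scale[of 0 0]
    by (auto simp: subspace_0 subspace_add subspace_scale linear_add linear_scale linear_0)
  then have "span B \<subseteq> {w \<in> W. g w = \<phi> w}"
    using B g by (intro span_minimal) auto
  then have "g w = \<phi> w" if "w \<in> W" for w using B that by auto
  moreover obtain C where "\<And>w. norm (g w) \<le> C * norm w" "0 < C"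
    using linear_bounded_pos[OF g(1)] by blast
  ultimately show ?thesis by (metis less_imp_le)
qed

text \<open>
  On the compact set where \<open>f \<le> 0\<close>, the penalty \<open>g\<close> is positive, so \<open>- f / g\<close> is bounded
  above there; any nonnegative \<open>M\<close> beyond that bound works.
\<close>

lemma compact_penalization:
  fixes f g :: "'a::metric_space \<Rightarrow> real"
  assumes K: "compact K" and f: "continuous_on K f" and g: "continuous_on K g"
    and g_nonneg: "\<And>x. x \<in> K \<Longrightarrow> 0 \<le> g x"
    and f_pos: "\<And>x. x \<in> K \<Longrightarrow> g x = 0 \<Longrightarrow> 0 < f x"
  shows "\<exists>M\<^sub>0. \<forall>M\<ge>M\<^sub>0. \<forall>x\<in>K. 0 \<le> f x + M * g x"
proof -
  define L where "L = {x \<in> K. f x \<le> 0}"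
  have "closedin (top_of_set K) L"
    using continuous_closedin_preimage[OF f closed_atMost[of 0]] by (simp add: L_def vimage_def Int_def)
  then have "compact L" using K closedin_compact by blast
  have cont: "continuous_on L f" "continuous_on L g"
    using f g by (auto simp: L_def intro: continuous_on_subset)
  have g_pos: "0 < g x" if "x \<in> L" for x
    using that g_nonneg[of x] f_pos[of x] by (force simp: L_def less_le)
  have "compact ((\<lambda>x. - f x / g x) ` L)"
    using \<open>compact L\<close> cont g_pos by (intro compact_continuous_image continuous_intros) force+
  then obtain M\<^sub>0 where M\<^sub>0: "\<And>x. x \<in> L \<Longrightarrow> - f x / g x \<le> M\<^sub>0"
    using bounded_imp_bdd_above[OF compact_imp_bounded] by (force simp: bdd_above_def)
  have "0 \<le> f x + M * g x" if "max M\<^sub>0 0 \<le> M" "x \<in> K" for M x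
  proof (cases "x \<in> L")
    case True
    then have "- f x \<le> M\<^sub>0 * g x" using M\<^sub>0[OF True] g_pos[OF True] by (simp add: divide_simps)
    also have "\<dots> \<le> M * g x" using that g_pos[OF True] by (intro mult_right_mono) auto
    finally show ?thesis by simp
  next
    case False
    then show ?thesis using that g_nonneg[of x] by (simp add: L_def)
  qed
  then show ?thesis by blast
qed

section \<open>Equality in the triangle inequality\<close>

definition mean_norm :: "('a::real_normed_vector)^'m \<Rightarrow> real" where
  "mean_norm X = (1 / real CARD('m)) * (\<Sum>j\<in>UNIV. norm (X $ j))"

text \<open>
  The $L^{1/\theta}$ norm of a tuple with respect to the uniform probability on the indices.
\<close>

definition power_norm :: "real \<Rightarrow> ('a::real_normed_vector)^'m \<Rightarrow> real" where
  "power_norm \<theta> X = ((1 / real CARD('m)) * (\<Sum>j\<in>UNIV. norm (X $ j) powr (1 / \<theta>))) powr \<theta>"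

lemma norm_mean_le_mean_norm: "norm (mean X) \<le> mean_norm X"
  unfolding mean_def mean_norm_def by (simp add: divide_right_mono norm_sum)

lemma mean_scale: "mean (c *\<^sub>R X) = c *\<^sub>R mean X"
  by (simp add: mean_def scaleR_sum_right[symmetric] mult.commute)

lemma mean_norm_scale: "0 \<le> c \<Longrightarrow> mean_norm (c *\<^sub>R X) = c * mean_norm X"
  by (simp add: mean_norm_def sum_distrib_left[symmetric])

lemma power_norm_scale:
  assumes "0 \<le> c" "0 < \<theta>"
  shows "power_norm \<theta> (c *\<^sub>R X) = c * power_norm \<theta> X"
  using assms by (simp add: power_norm_def powr_mult sum_distrib_left[symmetric] sum_nonneg
      powr_powr powr_divide)

lemma deviation_scale: "deviation (c *\<^sub>R X) = c *\<^sub>R deviation X"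
  by (simp add: deviation_def mean_scale vec_eq_iff scaleR_right_diff_distrib)

lemma continuous_on_mean [continuous_intros]: "continuous_on A (mean :: ('a::real_normed_vector)^'m \<Rightarrow> 'a)"
  unfolding mean_def by (intro continuous_intros)

lemma continuous_on_mean_norm [continuous_intros]:
  "continuous_on A (mean_norm :: ('a::real_normed_vector)^'m \<Rightarrow> real)"
  unfolding mean_norm_def by (intro continuous_intros)

lemma continuous_on_power_norm [continuous_intros]:
  "0 < \<theta> \<Longrightarrow> continuous_on A (power_norm \<theta> :: ('a::real_normed_vector)^'m \<Rightarrow> real)"
  unfolding power_norm_def
  by (intro continuous_intros continuous_on_powr') (auto intro!: sum_nonneg divide_nonneg_nonneg)

lemma continuous_on_deviation [continuous_intros]:
  "continuous_on A (deviation :: real^'l^'m \<Rightarrow> real^'l^'m)"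
  unfolding deviation_def by (intro continuous_intros)

lemma norm_deviation_le:
  fixes X :: "real^'l^'m"
  shows "norm (deviation X) \<le> 2 * real CARD('m) * mean_norm X"
proof -
  have "norm (deviation X) \<le> (\<Sum>j\<in>UNIV. norm (deviation X $ j))"
    unfolding norm_vec_def[of "deviation X"] by (rule L2_set_le_sum) simp
  also have "\<dots> \<le> (\<Sum>j\<in>UNIV. norm (X $ j) + mean_norm X)"
  proof (rule sum_mono)
    fix j :: 'm
    have "norm (X $ j - mean X) \<le> norm (X $ j) + norm (mean X)" by (rule norm_triangle_ineq4)
    then show "norm (deviation X $ j) \<le> norm (X $ j) + mean_norm X"
      using norm_mean_le_mean_norm[of X] by (simp add: deviation_def)
  qed
  also have "\<dots> = 2 * real CARD('m) * mean_norm X"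
    by (simp add: sum.distrib mean_norm_def)
  finally show ?thesis .
qed

text \<open>
  The gaps $|x_j||x| - x_j \cdot x$ in the Cauchy-Schwarz inequality are nonnegative, and their
  sum is $0$; so each of them vanishes.
\<close>

lemma mean_norm_eq_imp_nonneg_multiples:
  fixes X :: "('a::real_inner)^'m"
  assumes eq: "mean_norm X = norm (mean X)"
  shows "norm (mean X) *\<^sub>R X $ j = norm (X $ j) *\<^sub>R mean X"
proof -
  let ?u = "mean X"
  have sum_X: "(\<Sum>j\<in>UNIV. X $ j) = real CARD('m) *\<^sub>R ?u" by (simp add: mean_def)
  have sum_norm: "(\<Sum>j\<in>UNIV. norm (X $ j)) = real CARD('m) * norm ?u"
    using eq by (simp add: mean_norm_def field_simps)
  have "(\<Sum>j\<in>UNIV. norm (X $ j) * norm ?u - X $ j \<bullet> ?u)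
      = (\<Sum>j\<in>UNIV. norm (X $ j)) * norm ?u - (\<Sum>j\<in>UNIV. X $ j) \<bullet> ?u"
    by (simp add: sum_subtractf sum_distrib_right inner_sum_left)
  also have "\<dots> = 0"
    by (simp add: sum_X sum_norm power2_norm_eq_inner[symmetric] power2_eq_square)
  finally have "norm (X $ j) * norm ?u - X $ j \<bullet> ?u = 0"
    by (subst (asm) sum_nonneg_eq_0_iff) (auto simp: norm_cauchy_schwarz)
  then show ?thesis
    by (metis norm_cauchy_schwarz_eq eq_iff_diff_eq_0)
qed

text \<open>
  The vector is $v_j = |x_j|/|x| - 1$: the tuple is $x_j = (1 + v_j) x$, so its deviation is
  $v \otimes x$.  This is where membership in $\mathbb{M}^W$ comes from.
\<close>

lemma mean_norm_eq_imp_tensor: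
  fixes X :: "real^'l^'m"
  assumes eq: "mean_norm X = norm (mean X)" and dev: "deviation X \<in> W" and "X \<noteq> 0"
  shows "mean X \<noteq> 0"
    and "\<exists>v\<in>MW W. \<forall>j. norm (X $ j) = (1 + v $ j) * norm (mean X)"
proof -
  let ?u = "mean X"
  show u: "?u \<noteq> 0"
  proof
    assume "?u = 0"
    then have "(\<Sum>j\<in>UNIV. norm (X $ j)) = 0" using eq by (simp add: mean_norm_def)
    then have "\<forall>j. X $ j = 0" by (subst (asm) sum_nonneg_eq_0_iff) auto
    then show False using \<open>X \<noteq> 0\<close> by (simp add: vec_eq_iff)
  qed
  define v :: "real^'m" where "v = (\<chi> j. norm (X $ j) / norm ?u - 1)"
  have "X $ j = (norm (X $ j) / norm ?u) *\<^sub>R ?u" for j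
  proof -
    have "X $ j = (1 / norm ?u) *\<^sub>R (norm ?u *\<^sub>R X $ j)" using u by simp
    then show ?thesis by (simp only: mean_norm_eq_imp_nonneg_multiples[OF eq]) simp
  qed
  then have "tensor v ?u = deviation X"
    by (simp add: tensor_def deviation_def v_def vec_eq_iff scaleR_left_diff_distrib)
  moreover have "v \<in> zero_sum"
  proof -
    have "(\<Sum>j\<in>UNIV. norm (X $ j)) = real CARD('m) * norm ?u"
      using eq by (simp add: mean_norm_def field_simps)
    then show ?thesis
      using u by (simp add: zero_sum_def v_def sum_subtractf flip: sum_divide_distrib)
  qed
  ultimately have "v \<in> MW W"
    using dev u by (auto simp: MW_def v_def)
  moreover have "norm (X $ j) = (1 + v $ j) * norm ?u" for j using u by (simp add: v_def)
  ultimately show "\<exists>v\<in>MW W. \<forall>j. norm (X $ j) = (1 + v $ j) * norm ?u" by blast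
qed

lemma power_norm_le_exp_kappa:
  fixes X :: "real^'l^'m"
  assumes v: "v \<in> MW W" and \<theta>: "0 < \<theta>" and c: "0 \<le> c"
    and X: "\<And>j. norm (X $ j) = (1 + v $ j) * c"
  shows "power_norm \<theta> X \<le> exp (kappa W \<theta>) * c"
proof -
  have "power_norm \<theta> X = (moment v (1 / \<theta>) * c powr (1 / \<theta>)) powr \<theta>"
    using MW_nonneg[OF v] c
    by (simp add: power_norm_def moment_def X powr_mult sum_distrib_right)
  also have "\<dots> = moment v (1 / \<theta>) powr \<theta> * c"
    using moment_pos[OF v, of "1 / \<theta>"] c \<theta> by (simp add: powr_mult powr_powr)
  also have "moment v (1 / \<theta>) powr \<theta> = exp (kappa_vec v \<theta>)"
    using moment_pos[OF v, of "1 / \<theta>"] \<theta> by (simp add: powr_def kappa_vec_eq)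
  also have "exp (kappa_vec v \<theta>) * c \<le> exp (kappa W \<theta>) * c"
    using kappa_vec_le_kappa[OF v \<theta>] c by (intro mult_right_mono) auto
  finally show ?thesis .
qed

section \<open>The inequality on tuples\<close>

text \<open>
  Both sides are positively homogeneous in \<open>X\<close>, so it suffices to treat the unit sphere.  There
  the coefficient of \<open>M\<^sub>2\<close> is a penalty, and \<open>M\<^sub>1\<close> only has to be large
  enough to make the rest positive where the penalty vanishes.  On that set
  \<open>norm (deviation X) \<le> 2 m * norm (mean X)\<close> and the coefficient of \<open>M\<^sub>1\<close> is at least
  \<open>d * norm (mean X)\<close> with \<open>d\<close> as below.
\<close>

lemma eventually_tuple_inequality:
  fixes W :: "(real^'l^'m) set"
  assumes W: "subspace W" and \<theta>: "0 < \<theta>" and q: "0 \<le> q" "q * exp (kappa W \<theta>) < 1" and C: "0 \<le> C"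
  shows "\<forall>\<^sub>F M\<^sub>1 in at_top. \<forall>\<^sub>F M\<^sub>2 in at_top. \<forall>X. deviation X \<in> W \<longrightarrow>
    C * norm (deviation X) \<le> M\<^sub>1 * (norm (mean X) - q * power_norm \<theta> X) + M\<^sub>2 * (mean_norm X - norm (mean X))"
proof -
  define d where "d = 1 - q * exp (kappa W \<theta>)"
  have d: "0 < d" using q by (simp add: d_def)
  have "\<forall>\<^sub>F M\<^sub>2 in at_top. \<forall>X. deviation X \<in> W \<longrightarrow>
    C * norm (deviation X) \<le> M\<^sub>1 * (norm (mean X) - q * power_norm \<theta> X) + M\<^sub>2 * (mean_norm X - norm (mean X))"
    if M\<^sub>1: "C * (2 * real CARD('m)) / d < M\<^sub>1" for M\<^sub>1
  proof -
    define K where "K = sphere 0 1 \<inter> (deviation -` W)"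
    define f where "f = (\<lambda>X::real^'l^'m. M\<^sub>1 * (norm (mean X) - q * power_norm \<theta> X) - C * norm (deviation X))"
    define g where "g = (\<lambda>X::real^'l^'m. mean_norm X - norm (mean X))"
    have M\<^sub>1_nonneg: "0 \<le> M\<^sub>1" using M\<^sub>1 C d by (smt (verit) divide_nonneg_pos mult_nonneg_nonneg of_nat_0_le_iff)
    have "closed (deviation -` W)"
      using closed_subspace[OF W] continuous_on_deviation by (intro closed_vimage) auto
    then have "compact K" unfolding K_def by (intro compact_Int_closed) auto
    moreover have "continuous_on K f" "continuous_on K g"
      using \<theta> by (auto simp: f_def g_def intro!: continuous_intros)
    moreover have "0 \<le> g X" for X using norm_mean_le_mean_norm[of X] by (simp add: g_def)
    moreover have "0 < f X" if "X \<in> K" "g X = 0" for X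
    proof -
      have X: "deviation X \<in> W" "X \<noteq> 0" "mean_norm X = norm (mean X)"
        using that by (auto simp: K_def g_def)
      note u = mean_norm_eq_imp_tensor(1)[OF X(3,1,2)]
      obtain v where v: "v \<in> MW W" "\<And>j. norm (X $ j) = (1 + v $ j) * norm (mean X)"
        using mean_norm_eq_imp_tensor(2)[OF X(3,1,2)] by blast
      have "q * power_norm \<theta> X \<le> q * (exp (kappa W \<theta>) * norm (mean X))"
        using power_norm_le_exp_kappa[OF v(1) \<theta> _ v(2)] q by (intro mult_left_mono) auto
      then have "d * norm (mean X) \<le> norm (mean X) - q * power_norm \<theta> X"
        by (simp add: d_def algebra_simps)
      then have "M\<^sub>1 * (d * norm (mean X)) \<le> M\<^sub>1 * (norm (mean X) - q * power_norm \<theta> X)"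
        using M\<^sub>1_nonneg by (intro mult_left_mono)
      moreover have "C * norm (deviation X) \<le> C * (2 * real CARD('m) * norm (mean X))"
        using norm_deviation_le[of X] C X(3) by (intro mult_left_mono) auto
      moreover have "C * (2 * real CARD('m) * norm (mean X)) < M\<^sub>1 * (d * norm (mean X))"
        using M\<^sub>1 d u by (simp add: divide_simps algebra_simps)
      ultimately show ?thesis by (simp add: f_def)
    qed
    ultimately obtain M\<^sub>0 where M\<^sub>0: "\<And>M X. M\<^sub>0 \<le> M \<Longrightarrow> X \<in> K \<Longrightarrow> 0 \<le> f X + M * g X"
      using compact_penalization[of K f g] by metis
    have "0 \<le> f X + M * g X" if "M\<^sub>0 \<le> M" "deviation X \<in> W" for M X
    proof -
      define Y where "Y = (1 / norm X) *\<^sub>R X"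
      have XY: "X = norm X *\<^sub>R Y" by (cases "X = 0") (simp_all add: Y_def)
      have "f (c *\<^sub>R Y) + M * g (c *\<^sub>R Y) = c * (f Y + M * g Y)" if "0 \<le> c" for c
        using that by (simp add: f_def g_def mean_scale mean_norm_scale power_norm_scale
            deviation_scale \<theta> algebra_simps)
      then have eq: "f X + M * g X = norm X * (f Y + M * g Y)"
        by (metis XY norm_ge_zero)
      show ?thesis
      proof (cases "X = 0")
        case False
        then have "Y \<in> K"
          using that W by (auto simp: K_def Y_def deviation_scale subspace_scale)
        then show ?thesis using M\<^sub>0[OF that(1)] eq by simp
      qed (use eq in simp)
    qed
    then show ?thesis
      unfolding eventually_at_top_linorder by (intro exI[of _ M\<^sub>0]) (force simp: f_def g_def)
  qed
  then show ?thesis using eventually_gt_at_top[of "C * (2 * real CARD('m)) / d"]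
    by (rule eventually_mono[rotated])
qed

section \<open>The main inequality\<close>

lemma geometric_mean_between:
  fixes t s :: real
  assumes "0 \<le> t" "t \<le> s" "0 < \<theta>" "\<theta> < 1"
  shows "t \<le> t powr (1 - \<theta>) * s powr \<theta>" and "t powr (1 - \<theta>) * s powr \<theta> \<le> s"
proof -
  have "t = t powr (1 - \<theta>) * t powr \<theta>" using assms by (simp flip: powr_add)
  also have "\<dots> \<le> t powr (1 - \<theta>) * s powr \<theta>"
    using assms by (intro mult_left_mono powr_mono2) auto
  finally show "t \<le> t powr (1 - \<theta>) * s powr \<theta>" .
  have "t powr (1 - \<theta>) * s powr \<theta> \<le> s powr (1 - \<theta>) * s powr \<theta>"
    using assms by (intro mult_right_mono powr_mono2) auto
  also have "\<dots> = s" using assms by (simp flip: powr_add)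
  finally show "t powr (1 - \<theta>) * s powr \<theta> \<le> s" .
qed

text \<open>
  Hoelder's inequality with exponents $1/\theta$ and $1/(1-\theta)$, after each $s_j$ is replaced by
  its bound.  Collecting powers of $m$: the prefactor gives $-\alpha$, the bound on $s_j$ gives
  $(\alpha-1)\theta$, and averaging in \<open>power_norm\<close> gives $\theta$, in total
  $-\alpha(1-\theta)$.  This is the gain that the hypothesis weighs against $\kappa(\theta)$.
\<close>

lemma powr_term_bound:
  fixes X :: "real^'l^'m" and t s :: "real^'m"
  assumes \<theta>: "0 < \<theta>" "\<theta> < 1" and t: "\<And>j. 0 \<le> t $ j" and S: "0 \<le> S"
    and s: "\<And>j. 0 \<le> s $ j" "\<And>j. s $ j \<le> real CARD('m) powr (\<alpha> - 1) * S"
  shows "real CARD('m) powr (-\<alpha>) * (\<Sum>j\<in>UNIV. norm (X $ j) * t $ j powr (1 - \<theta>) * s $ j powr \<theta>)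
    \<le> real CARD('m) powr (- (\<alpha> * (1 - \<theta>))) * power_norm \<theta> X * (vsum t powr (1 - \<theta>) * S powr \<theta>)"
proof -
  define m where "m = real CARD('m)"
  have m: "0 < m" by (simp add: m_def)
  have "(\<Sum>j\<in>UNIV. norm (X $ j) * t $ j powr (1 - \<theta>) * s $ j powr \<theta>)
      \<le> (\<Sum>j\<in>UNIV. norm (X $ j) * t $ j powr (1 - \<theta>) * (m powr (\<alpha> - 1) * S) powr \<theta>)"
    using s \<theta> by (intro sum_mono mult_left_mono powr_mono2) (auto simp: m_def)
  also have "\<dots> = (\<Sum>j\<in>UNIV. (norm (X $ j) powr (1 / \<theta>)) powr \<theta> * t $ j powr (1 - \<theta>))
      * (m powr (\<alpha> - 1) * S) powr \<theta>"
    using \<theta> by (simp add: powr_powr sum_distrib_right)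
  also have "\<dots> \<le> ((\<Sum>j\<in>UNIV. norm (X $ j) powr (1 / \<theta>)) powr \<theta> * vsum t powr (1 - \<theta>))
      * (m powr (\<alpha> - 1) * S) powr \<theta>"
    unfolding vsum_def using \<theta> t by (intro mult_right_mono Holder_sum) auto
  also have "(\<Sum>j\<in>UNIV. norm (X $ j) powr (1 / \<theta>)) powr \<theta> = m powr \<theta> * power_norm \<theta> X"
    using m by (simp add: power_norm_def m_def[symmetric] powr_divide sum_nonneg)
  also have "(m powr (\<alpha> - 1) * S) powr \<theta> = m powr ((\<alpha> - 1) * \<theta>) * S powr \<theta>"
    using S by (simp add: powr_mult powr_powr)
  finally have "m powr (-\<alpha>) * (\<Sum>j\<in>UNIV. norm (X $ j) * t $ j powr (1 - \<theta>) * s $ j powr \<theta>)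
      \<le> m powr (-\<alpha>) * (m powr \<theta> * power_norm \<theta> X * vsum t powr (1 - \<theta>) * (m powr ((\<alpha> - 1) * \<theta>) * S powr \<theta>))"
    by (intro mult_left_mono) auto
  also have "\<dots> = (m powr (-\<alpha>) * m powr \<theta> * m powr ((\<alpha> - 1) * \<theta>)) * power_norm \<theta> X * (vsum t powr (1 - \<theta>) * S powr \<theta>)"
    by (simp add: ac_simps)
  also have "m powr (-\<alpha>) * m powr \<theta> * m powr ((\<alpha> - 1) * \<theta>) = m powr (- (\<alpha> * (1 - \<theta>)))"
    by (simp add: algebra_simps flip: powr_add)
  finally show ?thesis by (simp add: m_def)
qed

text \<open>
  The powers of $m$ cancel: $m^{-\alpha} m^{\alpha-1}$ is the weight $1/m$ of the
  means.  Against the value $(z - |x|) s$ at the mean this leaves the surplus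
  $(\frac1m \sum_j |x_j| - |x|) s$.
\<close>

lemma defect_term_bound:
  fixes X :: "real^'l^'m" and z s :: "real^'m"
  assumes z: "\<And>j. norm (X $ j) \<le> z $ j"
    and s: "\<And>j. s $ j \<le> real CARD('m) powr (\<alpha> - 1) * S"
  shows "real CARD('m) powr (-\<alpha>) * (\<Sum>j\<in>UNIV. (z $ j - norm (X $ j)) * s $ j) \<le> (mean z - mean_norm X) * S"
proof -
  define m where "m = real CARD('m)"
  have m: "0 < m" by (simp add: m_def)
  have "(\<Sum>j\<in>UNIV. (z $ j - norm (X $ j)) * s $ j)
      \<le> (\<Sum>j\<in>UNIV. (z $ j - norm (X $ j)) * (m powr (\<alpha> - 1) * S))"
    using z s by (intro sum_mono mult_left_mono) (auto simp: m_def)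
  also have "\<dots> = m * (mean z - mean_norm X) * (m powr (\<alpha> - 1) * S)"
    using m by (simp add: mean_def mean_norm_def m_def[symmetric] sum_subtractf right_diff_distrib
        flip: sum_distrib_right)
  finally have "m powr (-\<alpha>) * (\<Sum>j\<in>UNIV. (z $ j - norm (X $ j)) * s $ j)
      \<le> m powr (-\<alpha>) * (m * (mean z - mean_norm X) * (m powr (\<alpha> - 1) * S))"
    by (intro mult_left_mono) auto
  also have "\<dots> = (m powr (-\<alpha>) * m powr 1 * m powr (\<alpha> - 1)) * ((mean z - mean_norm X) * S)"
    using m by (simp add: ac_simps)
  also have "m powr (-\<alpha>) * m powr 1 * m powr (\<alpha> - 1) = 1"
    using m unfolding powr_add[symmetric] by simp
  finally show ?thesis by (simp add: m_def)
qed

lemma abs_term_bound: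
  fixes t p :: "real^'m"
  assumes t: "\<And>j. 0 \<le> t $ j" and "0 < \<alpha>" and p: "norm p \<le> P"
  shows "real CARD('m) powr (-\<alpha>) * (\<Sum>j\<in>UNIV. \<bar>real CARD('m) powr \<alpha> * y + p $ j\<bar> * t $ j)
    \<le> \<bar>y\<bar> * vsum t + P * vsum t"
proof -
  define m where "m = real CARD('m)"
  have m: "1 \<le> m" by (simp add: m_def Suc_leI)
  have "\<bar>m powr \<alpha> * y + p $ j\<bar> \<le> m powr \<alpha> * \<bar>y\<bar> + P" for j
    using component_le_norm_cart[of p j] p abs_triangle_ineq[of "m powr \<alpha> * y" "p $ j"]
    by (simp add: abs_mult)
  then have "(\<Sum>j\<in>UNIV. \<bar>m powr \<alpha> * y + p $ j\<bar> * t $ j) \<le> (\<Sum>j\<in>UNIV. (m powr \<alpha> * \<bar>y\<bar> + P) * t $ j)"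
    using t by (intro sum_mono mult_right_mono)
  also have "\<dots> = (m powr \<alpha> * \<bar>y\<bar> + P) * vsum t" by (simp add: vsum_def sum_distrib_left)
  finally have "m powr (-\<alpha>) * (\<Sum>j\<in>UNIV. \<bar>m powr \<alpha> * y + p $ j\<bar> * t $ j)
      \<le> m powr (-\<alpha>) * ((m powr \<alpha> * \<bar>y\<bar> + P) * vsum t)"
    by (intro mult_left_mono) auto
  also have "\<dots> = \<bar>y\<bar> * vsum t + m powr (-\<alpha>) * (P * vsum t)"
    using m by (simp add: powr_minus field_simps)
  also have "m powr (-\<alpha>) * (P * vsum t) \<le> P * vsum t"
  proof -
    have "m powr (-\<alpha>) \<le> 1" using m \<open>0 < \<alpha>\<close> powr_mono[of "-\<alpha>" 0 m] by simp
    moreover have "0 \<le> P * vsum t"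
      using t order_trans[OF norm_ge_zero p] by (auto simp: vsum_def intro!: mult_nonneg_nonneg sum_nonneg)
    ultimately show ?thesis using mult_right_mono[of "m powr (-\<alpha>)" 1] by simp
  qed
  finally show ?thesis by (simp add: m_def)
qed

lemma supersolution_if_tuple_inequality:
  fixes W :: "(real^'l^'m) set"
  assumes \<alpha>: "0 < \<alpha>" and \<theta>: "0 < \<theta>" "\<theta> < 1" and M: "0 \<le> M\<^sub>1" "0 \<le> M\<^sub>2"
    and \<phi>: "\<And>w. w \<in> W \<Longrightarrow> norm (\<phi> w) \<le> C * norm w"
    and key: "\<And>X. deviation X \<in> W \<Longrightarrow> C * norm (deviation X) \<le>
      M\<^sub>1 * (norm (mean X) - real CARD('m) powr (- (\<alpha> * (1 - \<theta>))) * power_norm \<theta> X)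
      + M\<^sub>2 * (mean_norm X - norm (mean X))"
  shows "supersolution W \<phi> \<alpha> (G_fun \<theta> M\<^sub>1 M\<^sub>2)"
  unfolding supersolution_def
proof
  show "boundary_inequality (G_fun \<theta> M\<^sub>1 M\<^sub>2)"
    using M by (simp add: boundary_inequality_def G_fun_def)
next
  define m where "m = real CARD('m)"
  have m: "0 < m" by (simp add: m_def)
  show "main_inequality W \<phi> \<alpha> (G_fun \<theta> M\<^sub>1 M\<^sub>2)"
    unfolding main_inequality_def
  proof (clarify)
    fix X :: "real^'l^'m" and y and z t s :: "real^'m"
    assume conf: "(X, y, z, t, s) \<in> config_space W"
    then have dev: "deviation X \<in> W" and z: "\<And>j. norm (X $ j) \<le> z $ j"
      and t: "\<And>j. 0 \<le> t $ j" and s: "\<And>j. 0 \<le> s $ j"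
      by (auto simp: config_space_def Omega_def)
    define T where "T = vsum t"
    define S where "S = combined_s \<alpha> t s"
    have TS: "0 \<le> T" "T \<le> S"
      using mean_in_Omega[OF conf] by (auto simp: Omega_def T_def S_def)
    \<comment> \<open>This bound is the purpose of the factor $m^{1-\alpha}$ in \<open>combined_s\<close>.\<close>
    have s_le: "s $ j \<le> m powr (\<alpha> - 1) * S" for j
    proof -
      have "m powr (1 - \<alpha>) * s $ j \<le> m powr (1 - \<alpha>) * Max (range (\<lambda>j. s $ j))"
        by (intro mult_left_mono Max_ge) auto
      also have "\<dots> \<le> S" by (simp add: S_def combined_s_def m_def)
      finally have "m powr (\<alpha> - 1) * (m powr (1 - \<alpha>) * s $ j) \<le> m powr (\<alpha> - 1) * S"
        by (intro mult_left_mono) auto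
      moreover have "m powr (\<alpha> - 1) * (m powr (1 - \<alpha>) * s $ j) = s $ j"
        using m unfolding mult.assoc[symmetric] powr_add[symmetric] by simp
      ultimately show ?thesis by simp
    qed
    define \<tau> where "\<tau> = T powr (1 - \<theta>) * S powr \<theta>"
    have \<tau>: "T \<le> \<tau>" "\<tau> \<le> S" "0 \<le> \<tau>"
      using geometric_mean_between[OF TS \<theta>] by (auto simp: \<tau>_def)
    define q where "q = m powr (- (\<alpha> * (1 - \<theta>)))"
    have 1: "m powr (-\<alpha>) * (\<Sum>j\<in>UNIV. \<bar>m powr \<alpha> * y + \<phi> (deviation X) $ j\<bar> * t $ j)
        \<le> \<bar>y\<bar> * T + C * norm (deviation X) * T"
      unfolding m_def T_def using \<phi>[OF dev] t \<alpha> by (intro abs_term_bound) auto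
    have 2: "m powr (-\<alpha>) * (\<Sum>j\<in>UNIV. norm (X $ j) * t $ j powr (1 - \<theta>) * s $ j powr \<theta>)
        \<le> q * power_norm \<theta> X * \<tau>"
      unfolding m_def T_def \<tau>_def q_def
      using \<theta> t s s_le TS by (intro powr_term_bound) (auto simp: m_def)
    have 3: "m powr (-\<alpha>) * (\<Sum>j\<in>UNIV. (z $ j - norm (X $ j)) * s $ j) \<le> (mean z - mean_norm X) * S"
      unfolding m_def using z s_le by (intro defect_term_bound) (auto simp: m_def)
    have "m powr (-\<alpha>) * (\<Sum>j\<in>UNIV. G_fun \<theta> M\<^sub>1 M\<^sub>2 (X $ j, m powr \<alpha> * y + \<phi> (deviation X) $ j, z $ j, t $ j, s $ j))
       = m powr (-\<alpha>) * (\<Sum>j\<in>UNIV. \<bar>m powr \<alpha> * y + \<phi> (deviation X) $ j\<bar> * t $ j)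
         + M\<^sub>1 * (m powr (-\<alpha>) * (\<Sum>j\<in>UNIV. norm (X $ j) * t $ j powr (1 - \<theta>) * s $ j powr \<theta>))
         + M\<^sub>2 * (m powr (-\<alpha>) * (\<Sum>j\<in>UNIV. (z $ j - norm (X $ j)) * s $ j))"
      by (simp add: G_fun_def sum.distrib mult.assoc distrib_left flip: sum_distrib_left)
    also have "\<dots> \<le> (\<bar>y\<bar> * T + C * norm (deviation X) * T) + M\<^sub>1 * (q * power_norm \<theta> X * \<tau>)
        + M\<^sub>2 * ((mean z - mean_norm X) * S)"
      using 1 2 3 M by (intro add_mono mult_left_mono)
    \<comment> \<open>The tuple inequality, scaled by \<open>\<tau>\<close>, absorbs the error of \<open>\<phi>\<close> because \<open>T \<le> \<tau>\<close>; the surplus of the last term may be taken with \<open>S\<close> because \<open>\<tau> \<le> S\<close>.\<close>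
    also have "\<dots> \<le> \<bar>y\<bar> * T + M\<^sub>1 * norm (mean X) * \<tau> + M\<^sub>2 * (mean z - norm (mean X)) * S"
    proof -
      have "0 \<le> C * norm (deviation X)" using \<phi>[OF dev] norm_ge_zero order_trans by blast
      then have "C * norm (deviation X) * T \<le> C * norm (deviation X) * \<tau>"
        using \<tau> by (intro mult_left_mono) auto
      also have "\<dots> \<le> (M\<^sub>1 * (norm (mean X) - q * power_norm \<theta> X) + M\<^sub>2 * (mean_norm X - norm (mean X))) * \<tau>"
        using key[OF dev] \<tau> by (intro mult_right_mono) (auto simp: q_def m_def)
      also have "\<dots> = M\<^sub>1 * (norm (mean X) - q * power_norm \<theta> X) * \<tau> + M\<^sub>2 * (mean_norm X - norm (mean X)) * \<tau>"
        by (simp add: distrib_right)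
      also have "\<dots> \<le> M\<^sub>1 * (norm (mean X) - q * power_norm \<theta> X) * \<tau> + M\<^sub>2 * (mean_norm X - norm (mean X)) * S"
        using \<tau> M norm_mean_le_mean_norm[of X] by (intro add_left_mono mult_left_mono) auto
      finally show ?thesis by (simp add: algebra_simps)
    qed
    also have "\<dots> = G_fun \<theta> M\<^sub>1 M\<^sub>2 (mean X, y, mean z, T, S)"
      by (simp add: G_fun_def \<tau>_def)
    finally show "real CARD('m) powr (-\<alpha>) *
          (\<Sum>j\<in>UNIV. G_fun \<theta> M\<^sub>1 M\<^sub>2 (X $ j, real CARD('m) powr \<alpha> * y + \<phi> (deviation X) $ j,
                         z $ j, t $ j, s $ j)) \<le> G_fun \<theta> M\<^sub>1 M\<^sub>2 (mean X, y, mean z, vsum t, combined_s \<alpha> t s)"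
      by (simp add: m_def T_def S_def)
  qed
qed

theorem theorem4p2:
  fixes W :: "(real^'l^'m) set"
    and \<phi> :: "real^'l^'m \<Rightarrow> real^'m"
    and \<alpha> :: real
  assumes "CARD('m) \<ge> 2"
    and "subspace W" and "W \<subseteq> zero_sum"
    and "linear_operator W zero_sum \<phi>"
    and "0 < \<alpha>" and "\<alpha> < 1"
    and "\<alpha> > - kappa_deriv_1 W / ln (real CARD('m))"
  shows "\<exists>\<theta>\<^sub>0<1. \<forall>\<theta>. 0 < \<theta> \<and> \<theta>\<^sub>0 < \<theta> \<and> \<theta> < 1 \<longrightarrow>
           (\<forall>\<^sub>F M\<^sub>1 in at_top. \<forall>\<^sub>F M\<^sub>2 in at_top. supersolution W \<phi> \<alpha> (G_fun \<theta> M\<^sub>1 M\<^sub>2))"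
proof -
  have "0 < ln (real CARD('m))" using assms(1) by simp
  then have "- kappa_deriv_1 W < \<alpha> * ln (real CARD('m))"
    using assms(7) by (simp only: pos_divide_less_eq)
  then obtain \<theta>\<^sub>0 where "\<theta>\<^sub>0 < 1"
    and \<theta>\<^sub>0: "\<And>\<theta>. \<theta>\<^sub>0 < \<theta> \<Longrightarrow> \<theta> < 1 \<Longrightarrow> kappa W \<theta> < \<alpha> * ln (real CARD('m)) * (1 - \<theta>)"
    using kappa_below_line_near_1[OF assms(2)] by blast
  obtain C where "0 \<le> C" and C: "\<And>w. w \<in> W \<Longrightarrow> norm (\<phi> w) \<le> C * norm w"
    using linear_operator_bounded[OF assms(2,4)] by blast
  have "\<forall>\<^sub>F M\<^sub>1 in at_top. \<forall>\<^sub>F M\<^sub>2 in at_top. supersolution W \<phi> \<alpha> (G_fun \<theta> M\<^sub>1 M\<^sub>2)"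
    if \<theta>: "0 < \<theta>" "\<theta>\<^sub>0 < \<theta>" "\<theta> < 1" for \<theta>
  proof -
    define q where "q = real CARD('m) powr (- (\<alpha> * (1 - \<theta>)))"
    have "q * exp (kappa W \<theta>) = exp (kappa W \<theta> - \<alpha> * ln (real CARD('m)) * (1 - \<theta>))"
      by (simp add: q_def powr_def algebra_simps flip: exp_add)
    also have "\<dots> < 1" using \<theta>\<^sub>0[OF \<theta>(2,3)] by simp
    finally have "q * exp (kappa W \<theta>) < 1" .
    then have "\<forall>\<^sub>F M\<^sub>1 in at_top. \<forall>\<^sub>F M\<^sub>2 in at_top. \<forall>X. deviation X \<in> W \<longrightarrow>
        C * norm (deviation X) \<le> M\<^sub>1 * (norm (mean X) - q * power_norm \<theta> X) + M\<^sub>2 * (mean_norm X - norm (mean X))"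
      using \<theta> \<open>0 \<le> C\<close> by (intro eventually_tuple_inequality[OF assms(2)]) (auto simp: q_def)
    then show ?thesis
      using eventually_ge_at_top[of 0]
    proof eventually_elim
      case (elim M\<^sub>1)
      from elim(1) eventually_ge_at_top[of 0] show ?case
      proof eventually_elim
        case (elim M\<^sub>2)
        show ?case
          using elim \<open>0 \<le> M\<^sub>1\<close> \<theta> C assms(5)
          by (intro supersolution_if_tuple_inequality[where C = C]) (auto simp: q_def)
      qed
    qed
  qed
  with \<open>\<theta>\<^sub>0 < 1\<close> show ?thesis by blast
qed

end
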